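(* There is a monotone Schauder basis of a Banach space that is flattening quasi-greedy but is not unconditional for constant coefficients (UCC).
   Context: $\mathbb{N}$ is the set of positive integers; the scalar field $\mathbb{F}$ is $\mathbb{R}$ or $\mathbb{C}$. A basis of a Banach space $X$ is a norm-bounded sequence $(x_n)_{n=1}^\infty$ in $X$ whose linear span is dense in $X$ and for which there is a norm-bounded sequence $(x_n^* )_{n=1}^\infty$ in $X^*$ with $x_n^*(x_k)=\delta_{n,k}$. A Schauder basis of $X$ is a sequence $(x_n)$ such that every $f\in X$ has a unique norm-convergent expansion $f=\sum_na_nx_n$; the Schauder bases considered are also bases in the previous sense. For finite $A\subset\mathbb{N}$, $S_A(f)=\sum_{n\in A}x_n^*(f)x_n$. A Schauder basis is monotone if $\sup_m\|S_{\{1,\dots,m\}}\|=1$. A finite set $A\subset\mathbb{N}$ is a greedy set of $f\in X$ if $|x_n^*(f)|\ge|x_k^*(f)|$ for all $n\in A$, $k\in\mathbb{N}\setminus A$. Let $\mathrm{sign}(\lambda)=\lambda/|\lambda|$ for $\lambda\ne0$ and $\mathrm{sign}(0)=1$. For $f\in X$ and nonempty finite $A$, the truncation operator is $$\mathcal{T}_A(f)=\min_{n\in A}|x_n^*(f)|\sum_{n\in A}\mathrm{sign}(x_n^*(f))\,x_n+f-S_A(f).$$ The basis is flattening quasi-greedy if there is a constant $C$ such that $\|\mathcal{T}_A(f)\|\le C\|f\|$ for all $f\in X$ and all nonempty greedy sets $A$ of $f$. The basis is UCC if there is a constant $C$ such that $\|\sum_{n\in A}b_nx_n\|\le C\|\sum_{n\in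 A}a_nx_n\|$ for all finite $A\subset\mathbb{N}$ and all scalar families with $|a_n|=1$ and $b_n\in\{0,a_n\}$ for all $n\in A$. *)

theory Defs
  imports "HOL-Analysis.Analysis" "HOL-Library.Function_Algebras"
begin

text \<open>
  HOL cannot quantify existentially over types, and the library has no type class of
  complex Banach spaces. A Banach space is therefore given by a linear subspace V of an ambient
  vector space together with a norm N on V; the values of N outside V are irrelevant.
\<close>

locale normed_space_on = vector_space scale
  for scale :: "'f::real_normed_field \<Rightarrow> 'v::ab_group_add \<Rightarrow> 'v" +
  fixes V :: "'v set" and N :: "'v \<Rightarrow> real"
  assumes subspace_V: "subspace V"
    and norm_nonneg: "f \<in> V \<Longrightarrow> 0 \<le> N f"
    and norm_eq_0_iff: "f \<in> V \<Longrightarrow> N f = 0 \<longleftrightarrow> f = 0"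
    and norm_scale: "f \<in> V \<Longrightarrow> N (scale c f) = norm c * N f"
    and norm_triangle: "f \<in> V \<Longrightarrow> g \<in> V \<Longrightarrow> N (f + g) \<le> N f + N g"
begin

text \<open>The case distinction is there because \<^locale>\<open>Metric_space\<close> requires
  symmetry and nonnegativity outside the carrier too.\<close>

definition norm_dist :: "'v \<Rightarrow> 'v \<Rightarrow> real" where
  "norm_dist f g = (if f \<in> V \<and> g \<in> V then N (f - g) else 0)"

sublocale metric: Metric_space V norm_dist
proof
  show "0 \<le> norm_dist f g" for f g
    by (simp add: norm_dist_def norm_nonneg subspace_diff subspace_V)
  show "norm_dist f g = norm_dist g f" for f g
  proof (cases "f \<in> V \<and> g \<in> V")
    case True
    then have "N (scale (- 1) (f - g)) = N (f - g)"
      by (simp add: norm_scale subspace_diff subspace_V del: scale_minus_left)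
    then show ?thesis by (simp add: norm_dist_def)
  qed (auto simp: norm_dist_def)
  show "norm_dist f g = 0 \<longleftrightarrow> f = g" if "f \<in> V" "g \<in> V" for f g
    using that by (simp add: norm_dist_def norm_eq_0_iff subspace_diff subspace_V)
  show "norm_dist f h \<le> norm_dist f g + norm_dist g h" if "f \<in> V" "g \<in> V" "h \<in> V" for f g h
    using norm_triangle[of "f - g" "g - h"] that
    by (simp add: norm_dist_def subspace_diff subspace_V)
qed

definition op_norm :: "('v \<Rightarrow> 'v) \<Rightarrow> ennreal" where
  "op_norm T = (SUP f \<in> {f \<in> V. N f \<le> 1}. ennreal (N (T f)))"

definition dual_norm :: "('v \<Rightarrow> 'f) \<Rightarrow> ennreal" where
  "dual_norm \<phi> = (SUP f \<in> {f \<in> V. N f \<le> 1}. ennreal (norm (\<phi> f)))"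

definition dual_space :: "('v \<Rightarrow> 'f) set" where
  "dual_space = {\<phi>. (\<forall>f\<in>V. \<forall>g\<in>V. \<phi> (f + g) = \<phi> f + \<phi> g) \<and>
     (\<forall>c. \<forall>f\<in>V. \<phi> (scale c f) = c * \<phi> f) \<and> dual_norm \<phi> < \<infinity>}"

definition schauder_basis :: "(nat \<Rightarrow> 'v) \<Rightarrow> bool" where
  "schauder_basis x \<longleftrightarrow> range x \<subseteq> V \<and>
     (\<forall>f\<in>V. \<exists>!a. limitin metric.mtopology (\<lambda>m. \<Sum>n<m. scale (a n) (x n)) f sequentially)"

end

locale banach_space_on = normed_space_on +
  assumes complete: "metric.mcomplete"

text \<open>Sequences are indexed from 0, so that \<open>x n\<close> is the (n+1)-st basis vector.
  The coordinate functionals \<open>\<phi>\<close> are determined on V by \<open>x\<close>, since the span of \<open>x\<close> is dense.\<close>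

locale basis_on = banach_space_on scale V N
  for scale :: "'f::real_normed_field \<Rightarrow> 'v::ab_group_add \<Rightarrow> 'v" and V N +
  fixes x :: "nat \<Rightarrow> 'v" and \<phi> :: "nat \<Rightarrow> 'v \<Rightarrow> 'f"
  assumes basis_in_V: "range x \<subseteq> V"
    and basis_bounded: "bdd_above (range (\<lambda>n. N (x n)))"
    and span_dense: "metric.mtopology closure_of span (range x) = V"
    and dual_in: "range \<phi> \<subseteq> dual_space"
    and dual_bounded: "(SUP n. dual_norm (\<phi> n)) < \<infinity>"
    and biorthogonal: "\<phi> n (x k) = (if n = k then 1 else 0)"
begin

definition coord_proj :: "nat set \<Rightarrow> 'v \<Rightarrow> 'v" where
  "coord_proj A f = (\<Sum>n\<in>A. scale (\<phi> n f) (x n))"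

definition monotone_basis :: bool where
  "monotone_basis \<longleftrightarrow> (SUP m. op_norm (coord_proj {..m})) = 1"

definition greedy_set :: "'v \<Rightarrow> nat set \<Rightarrow> bool" where
  "greedy_set f A \<longleftrightarrow> finite A \<and> (\<forall>n\<in>A. \<forall>k\<in>-A. norm (\<phi> k f) \<le> norm (\<phi> n f))"

text \<open>Unlike \<^const>\<open>sgn\<close>, this takes the value 1 at 0.\<close>

definition sign :: "'f \<Rightarrow> 'f" where
  "sign c = (if c = 0 then 1 else c / of_real (norm c))"

definition truncation :: "nat set \<Rightarrow> 'v \<Rightarrow> 'v" where
  "truncation A f =
     scale (of_real (Min ((\<lambda>n. norm (\<phi> n f)) ` A))) (\<Sum>n\<in>A. scale (sign (\<phi> n f)) (x n))
     + f - coord_proj A f"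

definition flattening_quasi_greedy :: bool where
  "flattening_quasi_greedy \<longleftrightarrow>
     (\<exists>C. \<forall>f\<in>V. \<forall>A. A \<noteq> {} \<longrightarrow> greedy_set f A \<longrightarrow> N (truncation A f) \<le> C * N f)"

definition UCC :: bool where
  "UCC \<longleftrightarrow> (\<exists>C. \<forall>A a b. finite A \<longrightarrow> (\<forall>n\<in>A. norm (a n) = 1 \<and> b n \<in> {0, a n}) \<longrightarrow>
     N (\<Sum>n\<in>A. scale (b n) (x n)) \<le> C * N (\<Sum>n\<in>A. scale (a n) (x n)))"

end

text \<open>
  The ambient space of all scalar sequences loses no generality: sending a vector to its
  coefficients identifies any space with a Schauder basis with a linear subspace of it.
\<close>

definition seq_scale :: "'f::field \<Rightarrow> (nat \<Rightarrow> 'f) \<Rightarrow> nat \<Rightarrow> 'f" where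
  "seq_scale c f = (\<lambda>n. c * f n)"

lemma vector_space_seq_scale: "vector_space seq_scale"
  by unfold_locales (auto simp: seq_scale_def algebra_simps)

end

theory Submission
  imports Defs
begin

text \<open>
  The space is \<open>bv\<^sub>0\<close>, the null sequences of bounded variation, normed by
  \<open>\<Sum>n. |c n - c (n + 1)|\<close>, with the unit vectors as basis. Truncation acts on the
  coefficients as the radial retraction onto a disc, which is Lipschitz and so does not increase
  the variation by more than a constant factor. But the constant sequence \<open>1, \<dots>, 1\<close> has norm 1,
  whereas its restriction to the even positions has large variation.
\<close>

section \<open>Null sequences of bounded variation and the unit vectors\<close>

definition bv0 :: "(nat \<Rightarrow> 'f::real_normed_field) set" where
  "bv0 = {c. c \<longlonglongrightarrow> 0 \<and> summable (\<lambda>n. norm (c n - c (Suc n)))}"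

definition bv_norm :: "(nat \<Rightarrow> 'f::real_normed_field) \<Rightarrow> real" where
  "bv_norm c = (\<Sum>n. norm (c n - c (Suc n)))"

definition unit_seq :: "nat \<Rightarrow> nat \<Rightarrow> 'f::real_normed_field" where
  "unit_seq n k = (if k = n then 1 else 0)"

definition coord :: "nat \<Rightarrow> (nat \<Rightarrow> 'f::real_normed_field) \<Rightarrow> 'f" where
  "coord n c = c n"

definition restrict_seq :: "nat set \<Rightarrow> (nat \<Rightarrow> 'f::real_normed_field) \<Rightarrow> nat \<Rightarrow> 'f" where
  "restrict_seq A c n = (if n \<in> A then c n else 0)"

text \<open>Turns partial sums, coordinate projections and the sums in UCC into explicit sequences,
  whose variation can then be computed.\<close>

lemma sum_unit_seq:
  assumes "finite A"
  shows "(\<Sum>n\<in>A. seq_scale (a n) (unit_seq n)) = restrict_seq A a"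
  using assms
proof (induction A rule: finite_induct)
  case empty
  then show ?case by (simp add: restrict_seq_def fun_eq_iff)
next
  case (insert n A)
  then show ?case
    by (auto simp: restrict_seq_def seq_scale_def unit_seq_def fun_eq_iff)
qed

lemma unit_seq_eq_restrict_seq: "unit_seq n = restrict_seq {n} (\<lambda>_. 1)"
  by (auto simp: fun_eq_iff unit_seq_def restrict_seq_def)

section \<open>Normed space structure\<close>

lemma subspace_bv0: "module.subspace seq_scale (bv0 :: (nat \<Rightarrow> 'f::real_normed_field) set)"
proof -
  interpret vector_space "seq_scale :: 'f \<Rightarrow> _"
    by (rule vector_space_seq_scale)
  have "f + g \<in> bv0" if "f \<in> bv0" "g \<in> bv0" for f g :: "nat \<Rightarrow> 'f"
  proof -
    have "(\<lambda>n. f n + g n) \<longlonglongrightarrow> 0"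
      using that tendsto_add[of f 0 sequentially g 0] by (simp add: bv0_def)
    moreover have "summable (\<lambda>n. norm ((f n + g n) - (f (Suc n) + g (Suc n))))"
    proof (rule summable_comparison_test')
      show "summable (\<lambda>n. norm (f n - f (Suc n)) + norm (g n - g (Suc n)))"
        using that by (simp add: bv0_def summable_add)
      show "norm (norm ((f n + g n) - (f (Suc n) + g (Suc n))))
          \<le> norm (f n - f (Suc n)) + norm (g n - g (Suc n))" if "n \<ge> 0" for n
        using norm_triangle_ineq[of "f n - f (Suc n)" "g n - g (Suc n)"]
        by (simp add: algebra_simps)
    qed
    ultimately show ?thesis by (simp add: bv0_def plus_fun_def)
  qed
  moreover have "seq_scale a f \<in> bv0" if "f \<in> bv0" for a and f :: "nat \<Rightarrow> 'f"
    using that tendsto_mult_right_zero[of f sequentially a]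
    by (simp add: bv0_def seq_scale_def norm_mult summable_mult flip: right_diff_distrib)
  ultimately show ?thesis
    by (simp add: subspace_def) (simp add: bv0_def zero_fun_def)
qed

lemma summable_bv0: "c \<in> bv0 \<Longrightarrow> summable (\<lambda>n. norm (c n - c (Suc n)))"
  by (simp add: bv0_def)

text \<open>Since \<open>c\<close> tends to 0, \<open>c m\<close> is the telescoping sum of all
  jumps from position m on; the triangle inequality for series does the rest.\<close>

lemma norm_le_variation_tail:
  fixes c :: "nat \<Rightarrow> 'f::{real_normed_field,banach}"
  assumes "c \<in> bv0"
  shows "norm (c m) \<le> (\<Sum>n. norm (c (n + m) - c (Suc (n + m))))"
proof -
  have "(\<lambda>n. c (n + m)) \<longlonglongrightarrow> 0"
    using assms by (simp add: bv0_def LIMSEQ_ignore_initial_segment)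
  from telescope_sums'[OF this] have "(\<lambda>n. c (n + m) - c (Suc (n + m))) sums c m"
    by simp
  moreover have "summable (\<lambda>n. norm (c (n + m) - c (Suc (n + m))))"
    using summable_ignore_initial_segment[OF summable_bv0[OF assms], of m] by simp
  ultimately show ?thesis
    using summable_norm sums_unique by metis
qed

lemma bv_norm_split:
  assumes "c \<in> bv0"
  shows "bv_norm c = (\<Sum>n. norm (c (n + m) - c (Suc (n + m)))) + (\<Sum>n<m. norm (c n - c (Suc n)))"
  unfolding bv_norm_def using suminf_split_initial_segment[OF summable_bv0[OF assms], of m] by simp

text \<open>Adds the initial part of the variation to the tail bound. This control of coordinates
  gives definiteness of the norm, coordinatewise limits of Cauchy sequences, uniqueness of
  expansions and bounded coordinate functionals.\<close>

lemma norm_le_bv_norm: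
  fixes c :: "nat \<Rightarrow> 'f::{real_normed_field,banach}"
  assumes "c \<in> bv0"
  shows "norm (c m) \<le> bv_norm c"
  using norm_le_variation_tail[OF assms, of m] bv_norm_split[OF assms, of m]
    sum_nonneg[of "{..<m}" "\<lambda>n. norm (c n - c (Suc n))"] by simp

lemma normed_space_on_bv0:
  "normed_space_on seq_scale (bv0 :: (nat \<Rightarrow> 'f::{real_normed_field,banach}) set) bv_norm"
proof -
  interpret vector_space "seq_scale :: 'f \<Rightarrow> _"
    by (rule vector_space_seq_scale)
  show ?thesis
  proof
    show "subspace (bv0 :: (nat \<Rightarrow> 'f) set)" by (rule subspace_bv0)
    fix f g :: "nat \<Rightarrow> 'f" assume f: "f \<in> bv0"
    show "0 \<le> bv_norm f"
      unfolding bv_norm_def using summable_bv0[OF f] by (rule suminf_nonneg) simp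
    show "bv_norm f = 0 \<longleftrightarrow> f = 0"
    proof
      assume "bv_norm f = 0"
      then have "f m = 0" for m
        using norm_le_bv_norm[OF f, of m] by simp
      then show "f = 0" by (simp add: fun_eq_iff)
    qed (simp add: bv_norm_def)
    show "bv_norm (seq_scale c f) = norm c * bv_norm f" for c
      using suminf_mult[OF summable_bv0[OF f], of "norm c"]
      by (simp add: bv_norm_def seq_scale_def norm_mult flip: right_diff_distrib)
    assume g: "g \<in> bv0"
    have "f + g \<in> bv0"
      using f g subspace_bv0 subspace_add by blast
    then have "bv_norm (f + g) \<le> (\<Sum>n. norm (f n - f (Suc n)) + norm (g n - g (Suc n)))"
      unfolding bv_norm_def
    proof (intro suminf_le summable_add summable_bv0 f g)
      show "norm ((f + g) n - (f + g) (Suc n)) \<le> norm (f n - f (Suc n)) + norm (g n - g (Suc n))"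
        for n
        using norm_triangle_ineq[of "f n - f (Suc n)" "g n - g (Suc n)"]
        by (simp add: algebra_simps)
    qed
    also have "\<dots> = bv_norm f + bv_norm g"
      unfolding bv_norm_def by (rule suminf_add[symmetric]) (intro summable_bv0 f g)+
    finally show "bv_norm (f + g) \<le> bv_norm f + bv_norm g" .
  qed
qed

interpretation bv0: normed_space_on seq_scale
  "bv0 :: (nat \<Rightarrow> 'f::{real_normed_field,banach}) set" bv_norm
  by (rule normed_space_on_bv0)

section \<open>Completeness\<close>

lemma bv_norm_le_partial:
  assumes "\<And>m. (\<Sum>n<m. norm (c n - c (Suc n))) \<le> B"
  shows "summable (\<lambda>n. norm (c n - c (Suc n)))" "bv_norm c \<le> B"
proof -
  show *: "summable (\<lambda>n. norm (c n - c (Suc n)))"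
    \<comment> \<open>\<open>bounded_imp_summable\<close> speaks of sums over \<open>{..n}\<close>,
      which are rewritten as sums over \<open>{..<Suc n}\<close> to match the assumption.\<close>
    using assms by (intro bounded_imp_summable[where B = B]) (simp_all only: norm_ge_zero flip: lessThan_Suc_atMost)
  show "bv_norm c \<le> B"
    unfolding bv_norm_def using * assms by (rule suminf_le_const)
qed

text \<open>A Cauchy sequence converges coordinatewise. Finite sums of jumps survive the
  coordinatewise limit with a bound that does not depend on their length, so the limit is also one
  in variation.\<close>

lemma banach_space_on_bv0:
  "banach_space_on seq_scale (bv0 :: (nat \<Rightarrow> 'f::{real_normed_field,banach}) set) bv_norm"
proof
  have "\<exists>c. limitin bv0.metric.mtopology \<sigma> c sequentially"
    if Cauchy_\<sigma>: "bv0.metric.MCauchy \<sigma>" for \<sigma> :: "nat \<Rightarrow> nat \<Rightarrow> 'f"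
  proof -
    have \<sigma>: "\<sigma> k \<in> bv0" for k
      using Cauchy_\<sigma> by (auto simp: bv0.metric.MCauchy_def)
    have diff: "f - g \<in> bv0" if "f \<in> bv0" "g \<in> bv0" for f g :: "nat \<Rightarrow> 'f"
      using that bv0.subspace_V by (rule bv0.subspace_diff[rotated])
    have "\<forall>e>0. \<exists>K. \<forall>j\<ge>K. \<forall>k\<ge>K. bv_norm (\<sigma> j - \<sigma> k) < e"
      using Cauchy_\<sigma> \<sigma> unfolding bv0.metric.MCauchy_def bv0.norm_dist_def by simp
    then obtain K where K: "bv_norm (\<sigma> j - \<sigma> k) < e" if "e > 0" "j \<ge> K e" "k \<ge> K e" for e j k
      by metis
    have "Cauchy (\<lambda>k. \<sigma> k n)" for n
    proof (rule metric_CauchyI)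
      fix e :: real assume "e > 0"
      have "dist (\<sigma> j n) (\<sigma> k n) < e" if "j \<ge> K e" "k \<ge> K e" for j k
        using norm_le_bv_norm[OF diff[OF \<sigma> \<sigma>], of j k n] K[OF \<open>e > 0\<close> that]
        by (simp add: dist_norm)
      then show "\<exists>M. \<forall>j\<ge>M. \<forall>k\<ge>M. dist (\<sigma> j n) (\<sigma> k n) < e" by blast
    qed
    then have "\<exists>l. (\<lambda>k. \<sigma> k n) \<longlonglongrightarrow> l" for n
      by (simp add: Cauchy_convergent_iff convergent_def)
    then obtain c where c: "(\<lambda>k. \<sigma> k n) \<longlonglongrightarrow> c n" for n
      by metis
    \<comment> \<open>With j and m fixed, k tends to infinity in a finite sum. Only the weak
      inequality survives the limit, which is why e / 2 is used for the convergence at the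
      end.\<close>
    have partial: "(\<Sum>n<m. norm ((\<sigma> j - c) n - (\<sigma> j - c) (Suc n))) \<le> e"
      if "e > 0" "j \<ge> K e" for e j m
    proof (rule LIMSEQ_le_const2)
      show "(\<lambda>k. \<Sum>n<m. norm ((\<sigma> j - \<sigma> k) n - (\<sigma> j - \<sigma> k) (Suc n)))
          \<longlonglongrightarrow> (\<Sum>n<m. norm ((\<sigma> j - c) n - (\<sigma> j - c) (Suc n)))"
        unfolding fun_diff_def by (intro tendsto_intros c)
      have "(\<Sum>n<m. norm ((\<sigma> j - \<sigma> k) n - (\<sigma> j - \<sigma> k) (Suc n))) \<le> e" if "k \<ge> K e" for k
      proof -
        have "(\<Sum>n<m. norm ((\<sigma> j - \<sigma> k) n - (\<sigma> j - \<sigma> k) (Suc n))) \<le> bv_norm (\<sigma> j - \<sigma> k)"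
          unfolding bv_norm_def
          by (rule sum_le_suminf[OF summable_bv0[OF diff[OF \<sigma> \<sigma>]]]) auto
        then show ?thesis using K[OF \<open>e > 0\<close> \<open>j \<ge> K e\<close> that] by simp
      qed
      then show "\<exists>M. \<forall>k\<ge>M. (\<Sum>n<m. norm ((\<sigma> j - \<sigma> k) n - (\<sigma> j - \<sigma> k) (Suc n))) \<le> e"
        by blast
    qed
    \<comment> \<open>Membership of \<open>\<sigma> j - c\<close> in \<open>bv0\<close> is still
      open, so \<open>norm_le_bv_norm\<close> is applied to \<open>\<sigma> j - \<sigma> k\<close>
      and the limit in k is taken afterwards.\<close>
    have bound: "norm (\<sigma> j n - c n) \<le> e" if "e > 0" "j \<ge> K e" for e j n
    proof (rule LIMSEQ_le_const2)
      show "(\<lambda>k. norm (\<sigma> j n - \<sigma> k n)) \<longlonglongrightarrow> norm (\<sigma> j n - c n)"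
        by (intro tendsto_intros c)
      have "norm (\<sigma> j n - \<sigma> k n) \<le> e" if "k \<ge> K e" for k
        using norm_le_bv_norm[OF diff[OF \<sigma> \<sigma>], of j k n] K[OF \<open>e > 0\<close> \<open>j \<ge> K e\<close> that]
        by simp
      then show "\<exists>M. \<forall>k\<ge>M. norm (\<sigma> j n - \<sigma> k n) \<le> e" by blast
    qed
    have "c \<longlonglongrightarrow> 0"
    proof (rule LIMSEQ_I)
      fix e :: real assume "e > 0"
      \<comment> \<open>\<open>\<sigma> ?j\<close> is within e / 2 of \<open>c\<close> uniformly in
        n, so its decay to 0 carries over to \<open>c\<close>.\<close>
      let ?j = "K (e / 2)"
      have "\<sigma> ?j \<longlonglongrightarrow> 0" using \<sigma> by (simp add: bv0_def)
      then obtain M where M: "norm (\<sigma> ?j n) < e / 2" if "n \<ge> M" for n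
        using \<open>e > 0\<close> LIMSEQ_D[of "\<sigma> ?j" 0 "e / 2"] by auto
      have "norm (c n - 0) < e" if "n \<ge> M" for n
        using M[OF that] bound[of "e / 2" ?j n] \<open>e > 0\<close> norm_triangle_sub[of "c n" "\<sigma> ?j n"]
        by (simp add: norm_minus_commute)
      then show "\<exists>M. \<forall>n\<ge>M. norm (c n - 0) < e" by blast
    qed
    \<comment> \<open>\<open>partial\<close> bounds the variation of a difference only, so
      \<open>\<sigma> (K 1) - c\<close> is placed in \<open>bv0\<close> first and \<open>c\<close>
      is recovered by subtraction. The tolerance 1 is arbitrary.\<close>
    moreover have "\<sigma> (K 1) \<longlonglongrightarrow> 0" using \<sigma> by (simp add: bv0_def)
    ultimately have "(\<sigma> (K 1) - c) \<longlonglongrightarrow> 0"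
      using tendsto_diff[of "\<sigma> (K 1)" 0 sequentially c 0] by (simp add: fun_diff_def)
    then have "\<sigma> (K 1) - c \<in> bv0"
      using bv_norm_le_partial(1)[OF partial[of 1]] by (simp add: bv0_def)
    from diff[OF \<sigma>[of "K 1"] this] have c_in: "c \<in> bv0" by simp
    have "\<forall>\<^sub>F k in sequentially. \<sigma> k \<in> bv0 \<and> bv0.norm_dist (\<sigma> k) c < e" if "e > 0" for e
    proof (rule eventually_sequentiallyI)
      fix j assume "j \<ge> K (e / 2)"
      then have "bv_norm (\<sigma> j - c) \<le> e / 2"
        using \<open>e > 0\<close> by (intro bv_norm_le_partial(2) partial) auto
      then show "\<sigma> j \<in> bv0 \<and> bv0.norm_dist (\<sigma> j) c < e"
        using \<open>e > 0\<close> \<sigma> c_in by (simp add: bv0.norm_dist_def)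
    qed
    then show ?thesis
      using c_in by (auto simp: bv0.metric.limitin_metric)
  qed
  then show "bv0.metric.mcomplete TYPE('f)"
    by (simp add: bv0.metric.mcomplete_def)
qed

section \<open>Finite sections and their convergence\<close>

lemma restrict_seq_bv0:
  assumes "finite A"
  shows "restrict_seq A c \<in> bv0"
proof -
  have "\<forall>\<^sub>F n in sequentially. restrict_seq A c n = 0"
  proof (rule eventually_sequentiallyI)
    \<comment> \<open>Inserting 0 keeps \<open>Max\<close> meaningful when \<open>A\<close> is
      empty.\<close>
    show "restrict_seq A c n = 0" if "n \<ge> Suc (Max (insert 0 A))" for n
      using that assms Max_ge[of "insert 0 A" n]
      by (cases "n \<in> A") (auto simp: restrict_seq_def simp del: Max_ge Max_insert)
  qed
  then obtain M where M: "restrict_seq A c n = 0" if "n \<ge> M" for n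
    by (auto simp: eventually_sequentially)
  have "summable (\<lambda>n. norm (restrict_seq A c n - restrict_seq A c (Suc n)))"
    by (rule summable_finite[of "{..<M}"]) (auto simp: M not_less)
  moreover have "restrict_seq A c \<longlonglongrightarrow> 0"
    by (rule tendsto_eventually) fact
  ultimately show ?thesis by (simp add: bv0_def)
qed

text \<open>Cutting off after position m leaves the earlier jumps and adds a single drop from
  \<open>c m\<close> to 0.\<close>

lemma bv_norm_restrict_initial:
  "bv_norm (restrict_seq {..m} c) = (\<Sum>n<m. norm (c n - c (Suc n))) + norm (c m)"
proof -
  have "bv_norm (restrict_seq {..m} c)
      = (\<Sum>n<Suc m. norm (restrict_seq {..m} c n - restrict_seq {..m} c (Suc n)))"
    unfolding bv_norm_def by (rule suminf_finite) (auto simp: restrict_seq_def)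
  also have "\<dots> = (\<Sum>n<m. norm (c n - c (Suc n))) + norm (c m)"
    by (simp add: restrict_seq_def)
  finally show ?thesis .
qed

text \<open>The drop created by the cut is at most the variation that the cut discards. This is what
  makes the basis monotone.\<close>

lemma bv_norm_restrict_initial_le:
  fixes c :: "nat \<Rightarrow> 'f::{real_normed_field,banach}"
  assumes "c \<in> bv0"
  shows "bv_norm (restrict_seq {..m} c) \<le> bv_norm c"
  using norm_le_variation_tail[OF assms, of m] bv_norm_split[OF assms, of m]
  by (simp add: bv_norm_restrict_initial)

text \<open>One jump up and one jump down; for n = 0 the jump up is absent, hence an inequality.
  Restricting to \<open>{..n}\<close> does not change the vector, so the formula for initial
  sections applies.\<close>

lemma bv_norm_unit_seq_le: "bv_norm (unit_seq n :: nat \<Rightarrow> 'f::real_normed_field) \<le> 2"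
proof -
  have "bv_norm (unit_seq n :: nat \<Rightarrow> 'f) = bv_norm (restrict_seq {..n} (unit_seq n :: nat \<Rightarrow> 'f))"
    by (rule arg_cong[where f = bv_norm]) (auto simp: fun_eq_iff restrict_seq_def unit_seq_def)
  also have "\<dots> = (\<Sum>k<n. if Suc k = n then 1 else 0) + 1"
    unfolding bv_norm_restrict_initial
    by (intro arg_cong2[where f = "(+)"] sum.cong) (auto simp: unit_seq_def)
  also have "\<dots> \<le> 2"
    by (cases n) simp_all
  finally show ?thesis .
qed

text \<open>The remainder has one jump of size at most \<open>norm (c m)\<close> at the cut and then
  the tail of the variation of \<open>c\<close>; both tend to 0.\<close>

lemma limitin_restrict_initial:
  fixes c :: "nat \<Rightarrow> 'f::{real_normed_field,banach}"
  assumes c: "c \<in> bv0"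
  shows "limitin bv0.metric.mtopology (\<lambda>m. restrict_seq {..<m} c) c sequentially"
proof -
  have le: "bv_norm (restrict_seq {..<m} c - c)
      \<le> norm (c m) + (bv_norm c - (\<Sum>n<m. norm (c n - c (Suc n))))" for m
  proof -
    let ?r = "restrict_seq {..<m} c - c"
    have r: "?r \<in> bv0"
      using restrict_seq_bv0 c bv0.subspace_V by (intro bv0.subspace_diff) auto
    \<comment> \<open>\<open>?r\<close> vanishes below m and equals -c from m on, so the only
      possible jump before m is the one from m - 1 to m, absent when m = 0.\<close>
    have "(\<Sum>n<m. norm (?r n - ?r (Suc n))) = (\<Sum>n<m. if Suc n = m then norm (c m) else 0)"
      by (rule sum.cong) (auto simp: restrict_seq_def)
    also have "\<dots> \<le> norm (c m)"
      by (cases m) simp_all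
    finally have "(\<Sum>n<m. norm (?r n - ?r (Suc n))) \<le> norm (c m)" .
    moreover have "(\<Sum>n. norm (?r (n + m) - ?r (Suc (n + m))))
        = (\<Sum>n. norm (c (n + m) - c (Suc (n + m))))"
      by (simp add: restrict_seq_def norm_minus_commute)
    ultimately show ?thesis
      using bv_norm_split[OF r, of m] bv_norm_split[OF c, of m] by simp
  qed
  have "(\<lambda>m. \<Sum>n<m. norm (c n - c (Suc n))) \<longlonglongrightarrow> bv_norm c"
    unfolding bv_norm_def by (rule summable_LIMSEQ[OF summable_bv0[OF c]])
  moreover have "c \<longlonglongrightarrow> 0" using c by (simp add: bv0_def)
  ultimately have lim: "(\<lambda>m. norm (c m) + (bv_norm c - (\<Sum>n<m. norm (c n - c (Suc n)))))
      \<longlonglongrightarrow> norm (0 :: 'f) + (bv_norm c - bv_norm c)"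
    by (intro tendsto_intros)
  have "\<forall>\<^sub>F m in sequentially. restrict_seq {..<m} c \<in> bv0
      \<and> bv0.norm_dist (restrict_seq {..<m} c) c < e" if "e > 0" for e
  proof -
    have "\<forall>\<^sub>F m in sequentially.
        norm (c m) + (bv_norm c - (\<Sum>n<m. norm (c n - c (Suc n)))) < e"
      using order_tendstoD(2)[OF lim, of e] that by simp
    then show ?thesis
    proof eventually_elim
      case (elim m)
      then show ?case
        using le[of m] c by (simp add: bv0.norm_dist_def restrict_seq_bv0)
    qed
  qed
  then show ?thesis
    using c by (auto simp: bv0.metric.limitin_metric)
qed

section \<open>The unit vectors as a Schauder basis with bounded coordinate functionals\<close>

lemma coord_dual_norm_le:
  "normed_space_on.dual_norm bv0 bv_norm
    (coord n :: (nat \<Rightarrow> 'f::{real_normed_field,banach}) \<Rightarrow> 'f) \<le> 1"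
  unfolding bv0.dual_norm_def
proof (rule SUP_least)
  fix f :: "nat \<Rightarrow> 'f" assume "f \<in> {f \<in> bv0. bv_norm f \<le> 1}"
  then show "ennreal (norm (coord n f)) \<le> 1"
    using norm_le_bv_norm[of f n] by (simp add: coord_def)
qed

lemma schauder_basis_bv0:
  "normed_space_on.schauder_basis seq_scale
    (bv0 :: (nat \<Rightarrow> 'f::{real_normed_field,banach}) set) bv_norm unit_seq"
  unfolding bv0.schauder_basis_def
proof (intro conjI ballI)
  show "range unit_seq \<subseteq> (bv0 :: (nat \<Rightarrow> 'f) set)"
    by (auto simp: unit_seq_eq_restrict_seq restrict_seq_bv0)
  fix f :: "nat \<Rightarrow> 'f" assume f: "f \<in> bv0"
  show "\<exists>!a. limitin bv0.metric.mtopology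
      (\<lambda>m. \<Sum>n<m. seq_scale (a n) (unit_seq n)) f sequentially"
  proof (rule ex1I)
    show "limitin bv0.metric.mtopology (\<lambda>m. \<Sum>n<m. seq_scale (f n) (unit_seq n)) f sequentially"
      using limitin_restrict_initial[OF f] by (simp add: sum_unit_seq)
  next
    fix a
    assume "limitin bv0.metric.mtopology
      (\<lambda>m. \<Sum>n<m. seq_scale (a n) (unit_seq n)) f sequentially"
    then have a: "limitin bv0.metric.mtopology (\<lambda>m. restrict_seq {..<m} a) f sequentially"
      by (simp add: sum_unit_seq)
    show "a = f"
    proof (rule ext, rule ccontr)
      fix k assume "a k \<noteq> f k"
      then have "\<forall>\<^sub>F m in sequentially.
          bv0.norm_dist (restrict_seq {..<m} a) f < norm (a k - f k)"
        using a by (simp add: bv0.metric.limitin_metric eventually_conj_iff)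
      then obtain M
        where M: "bv0.norm_dist (restrict_seq {..<m} a) f < norm (a k - f k)" if "m \<ge> M" for m
        by (auto simp: eventually_sequentially)
      \<comment> \<open>Beyond k, the k-th coordinate of the partial sum is already
        \<open>a k\<close>; the distance to \<open>f\<close> is then at least
        \<open>norm (a k - f k)\<close>, against the choice of \<open>M\<close>.\<close>
      let ?m = "max M (Suc k)"
      have "restrict_seq {..<?m} a - f \<in> bv0"
        using restrict_seq_bv0 f bv0.subspace_V by (intro bv0.subspace_diff) auto
      from norm_le_bv_norm[OF this, of k] M[of ?m] f show False
        by (simp add: bv0.norm_dist_def restrict_seq_bv0) (simp add: restrict_seq_def less_max_iff_disj)
    qed
  qed
qed

lemma basis_on_bv0:
  "basis_on seq_scale (bv0 :: (nat \<Rightarrow> 'f::{real_normed_field,banach}) set) bv_norm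
    unit_seq coord"
proof -
  interpret banach_space_on seq_scale "bv0 :: (nat \<Rightarrow> 'f) set" bv_norm
    by (rule banach_space_on_bv0)
  show ?thesis
  proof
    show "range unit_seq \<subseteq> (bv0 :: (nat \<Rightarrow> 'f) set)"
      by (auto simp: unit_seq_eq_restrict_seq restrict_seq_bv0)
    show "bdd_above (range (\<lambda>n. bv_norm (unit_seq n :: nat \<Rightarrow> 'f)))"
      using bv_norm_unit_seq_le by (auto intro!: bdd_aboveI)
    show "bv0.metric.mtopology closure_of bv0.span (range unit_seq) = (bv0 :: (nat \<Rightarrow> 'f) set)"
    proof
      show "bv0.metric.mtopology closure_of bv0.span (range unit_seq) \<subseteq> (bv0 :: (nat \<Rightarrow> 'f) set)"
        using closure_of_subset_topspace[of bv0.metric.mtopology] by simp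
      show "(bv0 :: (nat \<Rightarrow> 'f) set) \<subseteq> bv0.metric.mtopology closure_of bv0.span (range unit_seq)"
      proof
        fix f :: "nat \<Rightarrow> 'f" assume "f \<in> bv0"
        \<comment> \<open>Density of the span follows because the initial sections are finite
          combinations of unit vectors and converge to \<open>f\<close>.\<close>
        have "restrict_seq {..<m} f \<in> bv0.span (range unit_seq)" for m
          by (subst sum_unit_seq[symmetric]) (simp, intro bv0.span_sum bv0.span_scale bv0.span_base rangeI)
        then show "f \<in> bv0.metric.mtopology closure_of bv0.span (range unit_seq)"
          using limitin_restrict_initial[OF \<open>f \<in> bv0\<close>] restrict_seq_bv0 \<open>f \<in> bv0\<close>
          by (auto simp: bv0.metric.closure_of_sequentially
              intro!: exI[of _ "\<lambda>m. restrict_seq {..<m} f"])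
      qed
    qed
    show "range coord \<subseteq> (bv0.dual_space :: ((nat \<Rightarrow> 'f) \<Rightarrow> 'f) set)"
      using le_less_trans[OF coord_dual_norm_le ennreal_one_less_top]
      by (auto simp: bv0.dual_space_def coord_def seq_scale_def)
    have "(SUP n. bv0.dual_norm (coord n :: (nat \<Rightarrow> 'f) \<Rightarrow> 'f)) \<le> 1"
      by (rule SUP_least) (rule coord_dual_norm_le)
    then show "(SUP n. bv0.dual_norm (coord n :: (nat \<Rightarrow> 'f) \<Rightarrow> 'f)) < \<infinity>"
      by (rule le_less_trans) simp
    show "coord n (unit_seq k) = (if n = k then 1 else (0 :: 'f))" for n k
      by (simp add: coord_def unit_seq_def)
  qed
qed

interpretation bv0: basis_on seq_scale
  "bv0 :: (nat \<Rightarrow> 'f::{real_normed_field,banach}) set" bv_norm unit_seq coord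
  by (rule basis_on_bv0)

section \<open>Monotonicity\<close>

lemma coord_proj_bv0: "finite A \<Longrightarrow> bv0.coord_proj A f = restrict_seq A f"
  by (simp add: bv0.coord_proj_def sum_unit_seq coord_def)

lemma monotone_basis_bv0:
  "basis_on.monotone_basis seq_scale
    (bv0 :: (nat \<Rightarrow> 'f::{real_normed_field,banach}) set) bv_norm unit_seq coord"
  unfolding bv0.monotone_basis_def
proof (rule antisym)
  show "(SUP m. bv0.op_norm (bv0.coord_proj {..m} :: (nat \<Rightarrow> 'f) \<Rightarrow> _)) \<le> 1"
    unfolding bv0.op_norm_def
  proof (intro SUP_least)
    fix m and f :: "nat \<Rightarrow> 'f" assume "f \<in> {f \<in> bv0. bv_norm f \<le> 1}"
    then show "ennreal (bv_norm (bv0.coord_proj {..m} f)) \<le> 1"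
      using bv_norm_restrict_initial_le[of f m] by (simp add: coord_proj_bv0)
  qed
  \<comment> \<open>For the lower bound, \<open>unit_seq 0\<close> is fixed by the first projection
    and has norm exactly 1, as it only drops from 1 to 0.\<close>
  have restrict: "restrict_seq {..0} (unit_seq 0) = (unit_seq 0 :: nat \<Rightarrow> 'f)"
    by (auto simp: fun_eq_iff restrict_seq_def unit_seq_def)
  have norm: "bv_norm (unit_seq 0 :: nat \<Rightarrow> 'f) = 1"
    using bv_norm_restrict_initial[of 0 "unit_seq 0 :: nat \<Rightarrow> 'f"]
    by (simp add: restrict[simplified]) (simp add: unit_seq_def)
  have "1 = ennreal (bv_norm (bv0.coord_proj {..0} (unit_seq 0 :: nat \<Rightarrow> 'f)))"
    by (simp add: coord_proj_bv0 restrict[simplified] norm)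
  also have "\<dots> \<le> bv0.op_norm (bv0.coord_proj {..0} :: (nat \<Rightarrow> 'f) \<Rightarrow> _)"
    unfolding bv0.op_norm_def using bv0.basis_in_V
    by (intro SUP_upper) (auto simp: norm)
  also have "\<dots> \<le> (SUP m. bv0.op_norm (bv0.coord_proj {..m} :: (nat \<Rightarrow> 'f) \<Rightarrow> _))"
    by (rule SUP_upper) simp
  finally show "1 \<le> (SUP m. bv0.op_norm (bv0.coord_proj {..m} :: (nat \<Rightarrow> 'f) \<Rightarrow> _))" .
qed

section \<open>Radial retraction onto a disc, and truncation\<close>

definition clip :: "real \<Rightarrow> 'f::real_normed_field \<Rightarrow> 'f" where
  "clip t z = (if norm z \<le> t then z else of_real (t / norm z) * z)"

text \<open>In a general normed space the radial retraction need not be a contraction; the constant 2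
  avoids treating the two scalar fields separately.\<close>

lemma norm_clip_diff_le:
  fixes a b :: "'f::real_normed_field"
  assumes "t \<ge> 0"
  shows "norm (clip t a - clip t b) \<le> 2 * norm (a - b)"
proof -
  \<comment> \<open>By symmetry \<open>b\<close> may be taken as the element of larger norm.\<close>
  have aux: "norm (clip t a - clip t b) \<le> 2 * norm (a - b)" if ab: "norm a \<le> norm b" for a b :: 'f
  proof (cases "norm b \<le> t")
    case True
    then show ?thesis using ab by (simp add: clip_def)
  next
    case False
    then have b: "norm b > 0" using assms by linarith
    \<comment> \<open>\<open>s\<close> is the factor by which \<open>clip t\<close> scales
      \<open>a\<close>. The factor for \<open>b\<close> is \<open>t / norm b\<close>, which is no
      larger.\<close>
    define s where "s = (if norm a \<le> t then 1 else t / norm a)"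
    have s: "0 \<le> s" "s \<le> 1"
      using assms by (auto simp: s_def divide_le_eq_1)
    have s_norm: "0 \<le> s - t / norm b" "(s - t / norm b) * norm b \<le> norm b - norm a"
    proof -
      show "0 \<le> s - t / norm b"
        using False assms ab
        by (auto simp: s_def divide_le_eq_1 intro!: divide_left_mono mult_pos_pos)
      show "(s - t / norm b) * norm b \<le> norm b - norm a"
      proof (cases "norm a \<le> t")
        case True
        then show ?thesis using b by (simp add: s_def left_diff_distrib)
      next
        case False
        with assms have a: "norm a > 0" by linarith
        have "(s - t / norm b) * norm b = s * (norm b - norm a)"
          using False a b by (simp add: s_def field_simps)
        also have "\<dots> \<le> norm b - norm a"
          using s ab by (intro mult_left_le_one_le) auto
        finally show ?thesis .
      qed
    qed
    \<comment> \<open>Origin of the constant 2: each summand has norm at most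
      \<open>norm (a - b)\<close>, the first because s is at most 1, the second by
      \<open>s_norm\<close> and the reverse triangle inequality.\<close>
    have "clip t a - clip t b = of_real s * (a - b) + of_real (s - t / norm b) * b"
      using False by (simp add: clip_def s_def algebra_simps)
    also have "norm \<dots> \<le> s * norm (a - b) + (s - t / norm b) * norm b"
      using s(1) s_norm(1)
      by (intro order_trans[OF norm_triangle_ineq]) (simp add: norm_mult del: of_real_diff)
    also have "\<dots> \<le> norm (a - b) + (norm b - norm a)"
      using s s_norm(2) by (intro add_mono mult_left_le_one_le) auto
    also have "\<dots> \<le> 2 * norm (a - b)"
      using norm_triangle_ineq2[of b a] by (simp add: norm_minus_commute)
    finally show ?thesis .
  qed
  show ?thesis
    using aux[of a b] aux[of b a] by (cases "norm a \<le> norm b") (auto simp: norm_minus_commute)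
qed

lemma bv_norm_clip_le:
  assumes "c \<in> bv0" "t \<ge> 0"
  shows "bv_norm (\<lambda>n. clip t (c n)) \<le> 2 * bv_norm c"
proof (rule bv_norm_le_partial(2))
  fix m
  have "(\<Sum>n<m. norm (clip t (c n) - clip t (c (Suc n))))
      \<le> (\<Sum>n<m. 2 * norm (c n - c (Suc n)))"
    by (intro sum_mono norm_clip_diff_le assms)
  also have "\<dots> \<le> 2 * bv_norm c"
    unfolding bv_norm_def sum_distrib_left[symmetric]
    using summable_bv0[OF assms(1)] by (intro mult_left_mono sum_le_suminf) auto
  finally show "(\<Sum>n<m. norm (clip t (c n) - clip t (c (Suc n)))) \<le> 2 * bv_norm c" .
qed

text \<open>Greediness makes the threshold \<open>t\<close> separate the coordinates: outside
  \<open>A\<close> they lie in the disc of radius \<open>t\<close> and stay fixed, while on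
  \<open>A\<close> they have modulus at least \<open>t\<close> and are pulled back to modulus
  \<open>t\<close> with their sign kept.\<close>

lemma truncation_eq_clip:
  fixes f :: "nat \<Rightarrow> 'f::{real_normed_field,banach}"
  assumes "A \<noteq> {}" and greedy: "bv0.greedy_set f A"
  defines "t \<equiv> Min ((\<lambda>n. norm (f n)) ` A)"
  shows "bv0.truncation A f = (\<lambda>n. clip t (f n))" and "t \<ge> 0"
proof -
  have A: "finite A" and le: "\<And>n k. n \<in> A \<Longrightarrow> k \<notin> A \<Longrightarrow> norm (f k) \<le> norm (f n)"
    using greedy by (auto simp: bv0.greedy_set_def coord_def)
  \<comment> \<open>The minimum is attained at some index of \<open>A\<close>; comparing with that
    index bounds the coordinates outside \<open>A\<close>.\<close>
  have "t \<in> (\<lambda>n. norm (f n)) ` A"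
    unfolding t_def using A \<open>A \<noteq> {}\<close> by (intro Min_in) auto
  then show "t \<ge> 0" by auto
  have "norm (f n) \<le> t" if "n \<notin> A" for n
    using \<open>t \<in> _\<close> le that by auto
  moreover have "t \<le> norm (f n)" if "n \<in> A" for n
    unfolding t_def using that A by simp
  moreover have "bv0.truncation A f
      = seq_scale (of_real t) (restrict_seq A (\<lambda>n. bv0.sign (f n))) + f - restrict_seq A f"
    using A by (simp add: bv0.truncation_def coord_proj_bv0 sum_unit_seq coord_def t_def)
  \<comment> \<open>If n is in \<open>A\<close> and \<open>norm (f n) = t\<close>,
    \<open>clip\<close> is the identity and agrees with t times the sign. If moreover
    \<open>f n = 0\<close>, then t = 0, so the value 1 of the sign at 0 is multiplied by 0.\<close>
  ultimately show "bv0.truncation A f = (\<lambda>n. clip t (f n))"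
    using \<open>t \<ge> 0\<close>
    by (force simp: fun_eq_iff seq_scale_def restrict_seq_def clip_def bv0.sign_def
        intro: antisym)
qed

text \<open>The Lipschitz constant of \<open>clip t\<close> is 2 for every threshold, so one bound
  serves all vectors and greedy sets.\<close>

lemma flattening_quasi_greedy_bv0:
  "basis_on.flattening_quasi_greedy seq_scale
    (bv0 :: (nat \<Rightarrow> 'f::{real_normed_field,banach}) set) bv_norm unit_seq coord"
  unfolding bv0.flattening_quasi_greedy_def
proof (intro exI ballI allI impI)
  fix f :: "nat \<Rightarrow> 'f" and A
  assume "f \<in> bv0" "A \<noteq> {}" "bv0.greedy_set f A"
  then show "bv_norm (bv0.truncation A f) \<le> 2 * bv_norm f"
    by (simp add: truncation_eq_clip bv_norm_clip_le)
qed

section \<open>Failure of UCC\<close>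

lemma not_UCC_bv0:
  "\<not> basis_on.UCC seq_scale (bv_norm :: (nat \<Rightarrow> 'f::{real_normed_field,banach}) \<Rightarrow> real) unit_seq"
proof
  assume "bv0.UCC TYPE('f)"
  then obtain C where C: "bv_norm (\<Sum>n\<in>A. seq_scale (b n) (unit_seq n))
      \<le> C * bv_norm (\<Sum>n\<in>A. seq_scale (a n) (unit_seq n))"
    if "finite A" "\<forall>n\<in>A. norm (a n) = 1 \<and> b n \<in> {0, a n}" for A and a b :: "nat \<Rightarrow> 'f"
    unfolding bv0.UCC_def by blast
  define b :: "nat \<Rightarrow> 'f" where "b n = (if even n then 1 else 0)" for n
  obtain m :: nat where m: "C < real m"
    using reals_Archimedean2 by blast
  have "\<forall>n\<in>{..m}. norm (1 :: 'f) = 1 \<and> b n \<in> {0, 1}"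
    by (simp add: b_def)
  \<comment> \<open>Here \<open>a\<close> is constantly 1, so the norm on the right is 1: its only
    jump is the final drop.\<close>
  from C[OF finite_atMost this]
  have "bv_norm (restrict_seq {..m} b) \<le> C * bv_norm (restrict_seq {..m} (\<lambda>_. 1 :: 'f))"
    by (simp only: sum_unit_seq finite_atMost)
  moreover have "norm (b n - b (Suc n)) = 1" for n
    by (simp add: b_def)
  \<comment> \<open>The inequality now reads \<open>real m + norm (b m) \<le> C\<close>, with one
    unit jump for each of the m steps up to position m.\<close>
  ultimately show False
    using m norm_ge_zero[of "b m"] by (simp add: bv_norm_restrict_initial)
qed

theorem theorem4p1:
  shows "(\<exists>(V :: (nat \<Rightarrow> real) set) N x \<phi>.
            basis_on seq_scale V N x \<phi> \<and>
            normed_space_on.schauder_basis seq_scale V N x \<and>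
            basis_on.monotone_basis seq_scale V N x \<phi> \<and>
            basis_on.flattening_quasi_greedy seq_scale V N x \<phi> \<and>
            \<not> basis_on.UCC seq_scale N x)
       \<and> (\<exists>(V :: (nat \<Rightarrow> complex) set) N x \<phi>.
            basis_on seq_scale V N x \<phi> \<and>
            normed_space_on.schauder_basis seq_scale V N x \<and>
            basis_on.monotone_basis seq_scale V N x \<phi> \<and>
            basis_on.flattening_quasi_greedy seq_scale V N x \<phi> \<and>
            \<not> basis_on.UCC seq_scale N x)"
  \<comment> \<open>\<open>basis_on_bv0\<close> instantiates the witnesses left schematic by
    \<open>exI\<close>. The lemmas hold over every complete normed field of their type class, so the
    same rules prove the real and the complex case.\<close>
  by (intro conjI exI) (rule basis_on_bv0 schauder_basis_bv0 monotone_basis_bv0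
      flattening_quasi_greedy_bv0 not_UCC_bv0)+

end
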